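(* Suppose that $x$ is the primal variable corresponding to the dual variable $y\in\mathbb{R}^m$, i.e. $x=c+\mathbf{A}^\top y$. Then the dual suboptimality can be expressed as $$D(y^* )-D(y)=\tfrac12\|\bar c\,\mathbf 1-x\|^2 .$$ Moreover, for any $x\in\mathbb{R}^n$ we have $$\frac{1}{2n}\sum_{i=1}^n\sum_{j=1}^n (x_j-x_i)^2=\|\bar c\,\mathbf 1-x\|^2,$$ $$\sum_{e=(i,j)\in\mathcal E}|x_i-x_j|\le \sqrt{mn}\,\|\bar c\,\mathbf 1-x\|,$$ $$\sum_{e=(i,j)\in\mathcal E}|x_i-x_j|\ge \sqrt{\alpha(\mathcal G)}\,\|\bar c\,\mathbf 1-x\|,$$ $$\sum_{e=(i,j)\in\mathcal E}|x_i-x_j|\ge \epsilon\,\bigl|\{(i,j)\in\mathcal E:\ |x_i-x_j|\ge\epsilon\}\bigr| .$$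
   Context: $\mathcal G=(\mathcal V,\mathcal E)$ is an undirected connected graph with $\mathcal V=\{1,\dots,n\}$ and $|\mathcal E|=m$. Sums over $\mathcal E$ count each edge once. $\mathbf A\in\mathbb{R}^{m\times n}$ is the incidence matrix: row $e=(i,j)$ has $\mathbf A_{ei}=1$, $\mathbf A_{ej}=-1$ and all other entries $0$. $\mathbf 1\in\mathbb{R}^n$ is the all-ones vector and $\|\cdot\|$ the Euclidean norm. $c\in\mathbb{R}^n$ is the vector of initial (private) values and $\bar c=\frac1n\sum_{i=1}^n c_i$ is their average. The dual function is $D(y)=-(\mathbf A c)^\top y-\frac12\|\mathbf A^\top y\|^2$ for $y\in\mathbb{R}^m$, and $y^*$ is a maximizer of $D$ over $\mathbb{R}^m$. $\alpha(\mathcal G)$ is the algebraic connectivity, i.e. the second smallest eigenvalue of the Laplacian $\mathbf L=\mathbf A^\top\mathbf A$. $\epsilon>0$ is an error tolerance.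
   Formalization: The pair-sum identity and the lower bound with the algebraic connectivity are stated only for x whose average equals that of c (as for every x = c + Aᵀy); for arbitrary x they fail, e.g. x = 0 with nonzero average of c. The graph has at least one edge, so the connectivity is defined. *)

theory Defs
  imports "HOL-Analysis.Analysis" "HOL-Computational_Algebra.Polynomial"
begin

text \<open>
  The vertex set of a graph is the whole finite type of vertices. An undirected graph is given by
  its set of edges, in which each edge is listed once, as one of its two orderings.
\<close>

definition simple_graph :: "('v \<times> 'v) set \<Rightarrow> bool" where
  "simple_graph E \<longleftrightarrow> (\<forall>(i, j) \<in> E. i \<noteq> j \<and> (j, i) \<notin> E)"

definition connected_graph :: "('v \<times> 'v) set \<Rightarrow> bool" where
  "connected_graph E \<longleftrightarrow> (\<forall>u v. (u, v) \<in> (E \<union> E\<inverse>)\<^sup>*)"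

text \<open>
  The rows of the incidence matrix are indexed by a finite type, whose elements are mapped
  to edges by \<open>edge\<close>; this is meant for a bijection from the type onto the edge set.
\<close>

definition incidence :: "('e \<Rightarrow> 'v \<times> 'v) \<Rightarrow> real ^ 'v::finite ^ 'e::finite" where
  "incidence edge = (\<chi> e k. if k = fst (edge e) then 1 else if k = snd (edge e) then - 1 else 0)"

definition laplacian :: "('e::finite \<Rightarrow> 'v \<times> 'v) \<Rightarrow> real ^ 'v::finite ^ 'v" where
  "laplacian edge = transpose (incidence edge) ** incidence edge"

definition charpoly :: "real ^ 'k ^ 'k \<Rightarrow> real poly" where
  "charpoly M = det (\<chi> i j. (if i = j then [:0, 1:] else 0) - [:M $ i $ j:])"

text \<open>
  All real eigenvalues in ascending order, repeated according to their algebraic multiplicity.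
  For a symmetric matrix these are all its eigenvalues, and the list has one entry per dimension.
\<close>

definition eigenvalue_list :: "real ^ 'k ^ 'k \<Rightarrow> real list" where
  "eigenvalue_list M = sorted_list_of_multiset (proots (charpoly M))"

text \<open>
  Counting from 0, entry 1 is the second smallest eigenvalue. It is unspecified if there is
  only one vertex.
\<close>

definition algebraic_connectivity :: "('e::finite \<Rightarrow> 'v::finite \<times> 'v) \<Rightarrow> real" where
  "algebraic_connectivity edge = eigenvalue_list (laplacian edge) ! 1"

definition mean :: "real ^ 'v::finite \<Rightarrow> real" where
  "mean c = (1 / real CARD('v)) * (\<Sum>i\<in>UNIV. c $ i)"

definition dual_function :: "('e \<Rightarrow> 'v \<times> 'v) \<Rightarrow> real ^ 'v \<Rightarrow> real ^ 'e \<Rightarrow> real"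
  where
  "dual_function edge c y = - ((incidence edge *v c) \<bullet> y)
     - 1 / 2 * (norm (transpose (incidence edge) *v y))\<^sup>2"

end

theory Submission
  imports Defs
begin

text \<open>
  Write \<open>A\<close> for the incidence matrix, \<open>L = A\<^sup>T A\<close> and \<open>z = x - a 1\<close>, where \<open>a\<close> is the mean of \<open>c\<close>.

  \<^emph>\<open>Dual gap.\<close> Completing the square gives \<open>D(y) = (\<parallel>c\<parallel>\<^sup>2 - \<parallel>c + A\<^sup>T y\<parallel>\<^sup>2) / 2\<close>. At a maximiser the
  point \<open>c + A\<^sup>T y\<close> is stationary, hence in the kernel of \<open>A\<close>; as the graph is connected it is
  constant, and as \<open>A\<^sup>T\<close> preserves the mean it is \<open>a 1\<close>. The gap is then
  \<open>(\<parallel>x\<parallel>\<^sup>2 - \<parallel>a 1\<parallel>\<^sup>2) / 2\<close>, which is \<open>\<parallel>x - a 1\<parallel>\<^sup>2 / 2\<close> by Pythagoras.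

  \<^emph>\<open>Pair sum and upper bound.\<close> The sum of \<open>(x\<^sub>j - x\<^sub>i)\<^sup>2\<close> over all ordered pairs is
  \<open>2 n \<parallel>z\<parallel>\<^sup>2 - 2 (\<Sum>\<^sub>i z\<^sub>i)\<^sup>2\<close>. A simple graph contributes every edge in both orders to that sum, so
  the edge sum of squares is at most \<open>n \<parallel>z\<parallel>\<^sup>2\<close>, and Cauchy--Schwarz over the \<open>m\<close> edges yields
  the bound on the sum of absolute values.

  \<^emph>\<open>Lower bounds.\<close> The sum of absolute values over the edges is the 1-norm of \<open>A x\<close>, so it is at least the
  Euclidean norm of \<open>A x\<close>, whose square is \<open>z \<bullet> L z\<close>. For \<open>z\<close> orthogonal to \<open>1\<close> this is at least
  \<open>t \<parallel>z\<parallel>\<^sup>2\<close>, where \<open>t\<close> is the minimum of the Rayleigh quotient on the complement of \<open>1\<close>. It remains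
  to compare \<open>t\<close> with the algebraic connectivity, which is an entry of a list of roots of the
  characteristic polynomial. The full spectral theorem can be avoided: the minimum is attained
  at an eigenvector, so \<open>t\<close> is a root; connectedness makes \<open>t\<close> positive, so \<open>0\<close> and \<open>t\<close> are two
  different roots; and the second smallest root, counted with multiplicity, cannot exceed the
  larger of two different roots. The bound with \<open>\<epsilon>\<close> keeps only the summands that are at least \<open>\<epsilon>\<close>.
\<close>

section \<open>Eigenvalues of real matrices\<close>

lemma poly_charpoly: "poly (charpoly M) t = det (mat t - M)"
proof -
  have "poly ((if i = j then [:0, 1:] else 0) - [:M $ i $ j:]) t = (mat t - M) $ i $ j" for i j
    by (simp add: mat_def)
  then show ?thesis
    by (simp add: charpoly_def det_def poly_sum poly_prod)
qed

lemma charpoly_root_iff_eigenvalue: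
  fixes M :: "real ^ 'k ^ 'k"
  shows "poly (charpoly M) t = 0 \<longleftrightarrow> (\<exists>v. v \<noteq> 0 \<and> M *v v = t *\<^sub>R v)"
proof -
  have "mat t *v v = t *\<^sub>R v" for v :: "real ^ 'k"
    by (simp add: vec_eq_iff matrix_vector_mult_def mat_def if_distrib if_distribR cong: if_cong)
  then have "(mat t - M) *v v = t *\<^sub>R v - M *v v" for v :: "real ^ 'k"
    by (simp add: matrix_vector_mult_diff_rdistrib)
  then have ker: "(mat t - M) *v v = 0 \<longleftrightarrow> M *v v = t *\<^sub>R v" for v :: "real ^ 'k"
    by auto
  have "det (mat t - M) \<noteq> 0 \<longleftrightarrow> (\<forall>v. (mat t - M) *v v = 0 \<longrightarrow> v = 0)"
    by (metis invertible_det_nz invertible_left_inverse matrix_left_invertible_ker)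
  then show ?thesis
    unfolding poly_charpoly ker by blast
qed

text \<open>
  Every eigenvalue is bounded by the operator norm, so any number beyond it is not a root.
\<close>

lemma charpoly_nonzero:
  fixes M :: "real ^ 'k ^ 'k"
  shows "charpoly M \<noteq> 0"
proof
  assume "charpoly M = 0"
  then obtain v where v: "v \<noteq> 0" "M *v v = (onorm ((*v) M) + 1) *\<^sub>R v"
    using charpoly_root_iff_eigenvalue[of M "onorm ((*v) M) + 1"] by auto
  have pos: "0 \<le> onorm ((*v) M)"
    by (rule onorm_pos_le) simp
  have "norm (M *v v) \<le> onorm ((*v) M) * norm v"
    by (rule onorm) simp
  then have "(onorm ((*v) M) + 1) * norm v \<le> onorm ((*v) M) * norm v"
    using v pos by simp
  then show False
    using v by (simp add: algebra_simps)
qed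

lemma set_eigenvalue_list: "set (eigenvalue_list M) = {t. poly (charpoly M) t = 0}"
  by (simp add: eigenvalue_list_def charpoly_nonzero)

text \<open>
  The larger of two different eigenvalues cannot head the ascending list, so it stands at
  position 1 or later.
\<close>

lemma second_eigenvalue_le:
  assumes "poly (charpoly M) s = 0" "poly (charpoly M) t = 0" "s < t"
  shows "eigenvalue_list M ! 1 \<le> t"
proof -
  let ?l = "eigenvalue_list M"
  have srt: "sorted ?l"
    by (simp add: eigenvalue_list_def)
  obtain i where i: "i < length ?l" "?l ! i = s"
    using assms(1) set_eigenvalue_list[of M] by (metis (mono_tags) in_set_conv_nth mem_Collect_eq)
  obtain j where j: "j < length ?l" "?l ! j = t"
    using assms(2) set_eigenvalue_list[of M] by (metis (mono_tags) in_set_conv_nth mem_Collect_eq)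
  have "j \<noteq> 0"
    using sorted_nth_mono[OF srt, of 0 i] i j assms(3) by (intro notI) auto
  then show ?thesis
    using sorted_nth_mono[OF srt, of 1 j] j by auto
qed

lemma linear_coefficient_zero:
  fixes a b :: real
  assumes "\<And>r. 0 \<le> r * b + r\<^sup>2 * a"
  shows "b = 0"
proof -
  define k where "k = \<bar>a\<bar> + 1"
  have k: "k > 0" "a - k \<le> -1"
    by (auto simp: k_def)
  \<comment> \<open>A step against the slope, short enough for the linear term to win.\<close>
  have "0 \<le> k\<^sup>2 * ((- b / k) * b + (- b / k)\<^sup>2 * a)"
    using assms[of "- b / k"] by simp
  also have "\<dots> = b\<^sup>2 * (a - k)"
    using k by (simp add: field_simps power2_eq_square)
  also have "\<dots> \<le> b\<^sup>2 * (-1)"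
    using k by (intro mult_left_mono) auto
  finally show ?thesis
    by simp
qed

lemma norm_add_scaleR_squared:
  fixes p q :: "'a::real_inner"
  shows "(norm (p + r *\<^sub>R q))\<^sup>2 = (norm p)\<^sup>2 + r * (2 * (p \<bullet> q)) + r\<^sup>2 * (q \<bullet> q)"
  unfolding power2_norm_eq_inner
  by (simp add: inner_add_left inner_add_right inner_commute[of q p] power2_eq_square
      distrib_left)

lemma symmetric_matrix_inner:
  fixes M :: "real ^ 'k ^ 'k"
  assumes "transpose M = M"
  shows "x \<bullet> (M *v y) = (M *v x) \<bullet> y"
  by (metis assms dot_lmul_matrix transpose_matrix_vector)

text \<open>
  The quadratic form attains its minimum \<open>t\<close> on the compact unit sphere of the complement of \<open>u\<close>.
  At a minimiser \<open>v\<close> the form \<open>x \<bullet> M x - t (x \<bullet> x)\<close>, which is nonnegative on the complement,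
  vanishes, so its derivative \<open>M v - t v\<close> is orthogonal to the complement. As \<open>u\<close> is an
  eigenvector, the derivative also lies in the complement and is therefore \<open>0\<close>.
\<close>

lemma rayleigh_minimum_on_complement:
  fixes M :: "real ^ 'k ^ 'k"
  assumes sym: "transpose M = M"
    and eigen: "M *v u = s *\<^sub>R u"
    and nontrivial: "w \<noteq> 0" "w \<bullet> u = 0"
  obtains v t where "v \<noteq> 0" "v \<bullet> u = 0" "M *v v = t *\<^sub>R v"
    "\<And>x. x \<bullet> u = 0 \<Longrightarrow> t * (x \<bullet> x) \<le> x \<bullet> (M *v x)"
proof -
  let ?K = "sphere 0 1 \<inter> {x. u \<bullet> x = 0}"
  have normalised: "x /\<^sub>R norm x \<in> ?K" if "x \<noteq> 0" "x \<bullet> u = 0" for x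
    using that by (simp add: inner_commute)
  have "compact ?K"
    by (intro compact_Int_closed closed_hyperplane) simp
  moreover have "?K \<noteq> {}"
    using normalised[OF nontrivial] by blast
  moreover have "continuous_on ?K (\<lambda>x. x \<bullet> (M *v x))"
    by (intro continuous_intros linear_continuous_on) simp
  ultimately obtain v where v: "v \<in> ?K" "\<And>x. x \<in> ?K \<Longrightarrow> v \<bullet> (M *v v) \<le> x \<bullet> (M *v x)"
    using continuous_attains_inf[of ?K "\<lambda>x. x \<bullet> (M *v x)"] by blast
  define t where "t = v \<bullet> (M *v v)"
  have v1: "v \<bullet> v = 1" and vu: "v \<bullet> u = 0"
    using v(1) by (auto simp: inner_commute dot_square_norm)
  have min: "t * (x \<bullet> x) \<le> x \<bullet> (M *v x)" if x: "x \<bullet> u = 0" for x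
  proof (cases "x = 0")
    case False
    have "t \<le> (x /\<^sub>R norm x) \<bullet> (M *v (x /\<^sub>R norm x))"
      unfolding t_def by (rule v(2)) (rule normalised[OF False x])
    also have "\<dots> = (x \<bullet> (M *v x)) / (x \<bullet> x)"
      by (simp add: matrix_vector_mult_scaleR dot_square_norm power2_eq_square divide_inverse)
    finally show ?thesis
      using False by (simp add: pos_le_divide_eq)
  qed simp
  have orth: "w \<bullet> (M *v v - t *\<^sub>R v) = 0" if w: "w \<bullet> u = 0" for w
  proof -
    have swap: "v \<bullet> (M *v w) = w \<bullet> (M *v v)"
      using symmetric_matrix_inner[OF sym, of v w] by (simp add: inner_commute)
    have "0 \<le> r * (2 * (w \<bullet> (M *v v - t *\<^sub>R v))) + r\<^sup>2 * (w \<bullet> (M *v w) - t * (w \<bullet> w))" for r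
    proof -
      have "(v + r *\<^sub>R w) \<bullet> u = 0"
        using vu w by (simp add: inner_add_left)
      then have "0 \<le> (v + r *\<^sub>R w) \<bullet> (M *v (v + r *\<^sub>R w)) - t * ((v + r *\<^sub>R w) \<bullet> (v + r *\<^sub>R w))"
        using min by simp
      also have "\<dots> = r * (2 * (w \<bullet> (M *v v - t *\<^sub>R v))) + r\<^sup>2 * (w \<bullet> (M *v w) - t * (w \<bullet> w))"
        by (simp add: swap v1 inner_commute[of v w] t_def[symmetric] algebra_simps power2_eq_square)
      finally show ?thesis .
    qed
    then show ?thesis
      using linear_coefficient_zero by fastforce
  qed
  have "(M *v v - t *\<^sub>R v) \<bullet> u = 0"
    using symmetric_matrix_inner[OF sym, of v u] vu by (simp add: inner_diff_left eigen)
  then have "M *v v = t *\<^sub>R v"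
    using orth by (metis inner_eq_zero_iff eq_iff_diff_eq_0)
  moreover have "v \<noteq> 0"
    using v1 by auto
  ultimately show thesis
    using that vu min by blast
qed

section \<open>Means, pairwise differences and differences along edges\<close>

lemma inner_one_eq_mean: "1 \<bullet> (x :: real ^ 'v) = real CARD('v) * mean x"
  by (simp add: mean_def inner_vec_def)

lemma norm_diff_mean:
  fixes x :: "real ^ 'v"
  shows "(norm (mean x *\<^sub>R 1 - x))\<^sup>2 = (norm x)\<^sup>2 - (norm (mean x *\<^sub>R (1 :: real ^ 'v)))\<^sup>2"
proof -
  have "(1 :: real ^ 'v) \<bullet> 1 = real CARD('v)"
    by (simp add: inner_vec_def)
  then show ?thesis
    unfolding power2_norm_eq_inner
    by (simp add: inner_diff_left inner_diff_right inner_commute[of x 1] inner_one_eq_mean)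
qed

lemma sum_pairs_diff_squared:
  fixes x :: "real ^ 'v"
  shows "(\<Sum>i\<in>UNIV. \<Sum>j\<in>UNIV. (x $ j - x $ i)\<^sup>2)
    = 2 * real CARD('v) * (norm (a *\<^sub>R 1 - x))\<^sup>2 - 2 * (\<Sum>i\<in>UNIV. x $ i - a)\<^sup>2"
proof -
  define z where "z i = x $ i - a" for i
  have "(x $ j - x $ i)\<^sup>2 = (z j)\<^sup>2 + (z i)\<^sup>2 - 2 * (z i * z j)" for i j
    by (simp add: z_def power2_eq_square algebra_simps)
  then have "(\<Sum>i\<in>UNIV. \<Sum>j\<in>UNIV. (x $ j - x $ i)\<^sup>2)
      = 2 * real CARD('v) * (\<Sum>i\<in>UNIV. (z i)\<^sup>2) - 2 * (\<Sum>i\<in>UNIV. z i)\<^sup>2"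
    by (simp add: sum.distrib sum_subtractf sum_product power2_eq_square flip: sum_distrib_left)
  moreover have "(norm (a *\<^sub>R 1 - x))\<^sup>2 = (\<Sum>i\<in>UNIV. (z i)\<^sup>2)"
    unfolding power2_norm_eq_inner inner_vec_def z_def
    by (simp add: power2_eq_square algebra_simps)
  ultimately show ?thesis
    by (simp add: z_def)
qed

lemma sum_diff_mean: "(\<Sum>i\<in>UNIV. (x :: real ^ 'v) $ i - mean x) = 0"
  by (simp add: sum_subtractf mean_def)

text \<open>
  The edges and their reversals are disjoint sets of ordered pairs, and both have the same sum.
\<close>

lemma sum_edges_squared_le_pairs:
  fixes x :: "real ^ 'v"
  assumes "simple_graph E"
  shows "2 * (\<Sum>(i, j)\<in>E. (x $ i - x $ j)\<^sup>2) \<le> (\<Sum>i\<in>UNIV. \<Sum>j\<in>UNIV. (x $ j - x $ i)\<^sup>2)"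
proof -
  let ?f = "\<lambda>(i, j). (x $ i - x $ j)\<^sup>2"
  have "sum ?f (E\<inverse>) = sum ?f E"
    by (rule sum.reindex_bij_witness[where i = prod.swap and j = prod.swap])
      (auto simp: power2_commute)
  then have "2 * sum ?f E = sum ?f E + sum ?f (E\<inverse>)"
    by simp
  also have "\<dots> = sum ?f (E \<union> E\<inverse>)"
    using assms by (intro sum.union_disjoint[symmetric]) (auto simp: simple_graph_def)
  also have "\<dots> \<le> sum ?f (UNIV \<times> UNIV)"
    by (rule sum_mono2) auto
  also have "\<dots> = (\<Sum>i\<in>UNIV. \<Sum>j\<in>UNIV. (x $ j - x $ i)\<^sup>2)"
    by (simp add: sum.cartesian_product power2_commute)
  finally show ?thesis .
qed

lemma sum_edges_le:
  fixes x :: "real ^ 'v"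
  assumes "simple_graph E"
  shows "(\<Sum>(i, j)\<in>E. \<bar>x $ i - x $ j\<bar>)
    \<le> sqrt (real (card E) * real CARD('v)) * norm (a *\<^sub>R 1 - x)"
proof -
  have "(\<Sum>(i, j)\<in>E. \<bar>x $ i - x $ j\<bar>)\<^sup>2 \<le> (\<Sum>(i, j)\<in>E. (x $ i - x $ j)\<^sup>2) * card E"
    using sum_squared_le_sum_of_squares[of "\<lambda>(i, j). \<bar>x $ i - x $ j\<bar>" E]
    by (simp add: case_prod_beta)
  also have "\<dots> \<le> (real CARD('v) * (norm (a *\<^sub>R 1 - x))\<^sup>2) * card E"
  proof (rule mult_right_mono)
    show "(\<Sum>(i, j)\<in>E. (x $ i - x $ j)\<^sup>2) \<le> real CARD('v) * (norm (a *\<^sub>R 1 - x))\<^sup>2"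
      using sum_edges_squared_le_pairs[OF assms, of x] sum_pairs_diff_squared[of x a]
        zero_le_power2[of "\<Sum>i\<in>UNIV. x $ i - a"] by linarith
  qed simp
  also have "\<dots> = (sqrt (real (card E) * real CARD('v)) * norm (a *\<^sub>R 1 - x))\<^sup>2"
    by (simp add: power_mult_distrib)
  finally show ?thesis
    by (rule power2_le_imp_le) simp
qed

lemma sum_ge_threshold_times_card:
  fixes f :: "'a \<Rightarrow> real"
  assumes "finite A" "\<And>e. e \<in> A \<Longrightarrow> 0 \<le> f e"
  shows "\<epsilon> * real (card {e \<in> A. \<epsilon> \<le> f e}) \<le> sum f A"
proof -
  have "\<epsilon> * real (card {e \<in> A. \<epsilon> \<le> f e}) = (\<Sum>e\<in>{e \<in> A. \<epsilon> \<le> f e}. \<epsilon>)"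
    by simp
  also have "\<dots> \<le> sum f {e \<in> A. \<epsilon> \<le> f e}"
    by (rule sum_mono) simp
  also have "\<dots> \<le> sum f A"
    using assms by (intro sum_mono2) auto
  finally show ?thesis .
qed

section \<open>Incidence matrix and Laplacian\<close>

lemma incidence_mult:
  assumes "fst (edge e) \<noteq> snd (edge e)"
  shows "(incidence edge *v x) $ e = x $ fst (edge e) - x $ snd (edge e)"
proof -
  have "(incidence edge *v x) $ e
      = (\<Sum>k\<in>UNIV. (if k = fst (edge e) then x $ k else 0) - (if k = snd (edge e) then x $ k else 0))"
    unfolding matrix_vector_mult_def incidence_def using assms
    by (auto intro!: sum.cong)
  then show ?thesis
    by (simp add: sum_subtractf)
qed

lemma connected_graph_constant:
  fixes x :: "real ^ 'v"
  assumes "connected_graph E" "\<And>i j. (i, j) \<in> E \<Longrightarrow> x $ i = x $ j"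
  shows "x = (x $ u) *\<^sub>R 1"
proof -
  have "x $ k = x $ u" for k
  proof -
    have "(u, k) \<in> (E \<union> E\<inverse>)\<^sup>*"
      using assms(1) by (simp add: connected_graph_def)
    then show ?thesis
      by induction (auto dest: assms(2))
  qed
  then show ?thesis
    by (simp add: vec_eq_iff)
qed

lemma inner_laplacian:
  "x \<bullet> (laplacian edge *v y) = (incidence edge *v x) \<bullet> (incidence edge *v y)"
  by (metis dot_lmul_matrix inner_commute laplacian_def matrix_vector_mul_assoc
      transpose_matrix_vector)

lemma transpose_laplacian: "transpose (laplacian edge) = laplacian edge"
  by (simp add: laplacian_def matrix_transpose_mul)

context
  fixes E :: "('v::finite \<times> 'v) set"
    and edge :: "'e::finite \<Rightarrow> 'v \<times> 'v"
  assumes simple: "simple_graph E"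
    and bij: "bij_betw edge UNIV E"
begin

lemma edge_ends_differ: "fst (edge e) \<noteq> snd (edge e)"
proof -
  have "edge e \<in> E"
    using bij by (auto simp: bij_betw_def)
  then show ?thesis
    using simple by (auto simp: simple_graph_def)
qed

lemma sum_edges_eq_sum_incidence:
  "(\<Sum>(i, j)\<in>E. f (x $ i - x $ j)) = (\<Sum>e\<in>UNIV. f ((incidence edge *v x) $ e))"
  unfolding sum.reindex_bij_betw[OF bij, symmetric]
  by (simp add: incidence_mult edge_ends_differ case_prod_beta)

lemma incidence_one: "incidence edge *v 1 = 0"
  by (simp add: vec_eq_iff incidence_mult edge_ends_differ)

lemma mean_add_transpose_incidence: "mean (c + transpose (incidence edge) *v y) = mean c"
proof -
  have "1 \<bullet> (transpose (incidence edge) *v y) = (incidence edge *v 1) \<bullet> y"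
    by (metis dot_lmul_matrix inner_commute transpose_matrix_vector)
  then have "1 \<bullet> (c + transpose (incidence edge) *v y) = 1 \<bullet> c"
    by (simp add: inner_add_right incidence_one)
  then show ?thesis
    by (simp add: inner_one_eq_mean)
qed

lemma incidence_kernel_constant:
  assumes "connected_graph E" "incidence edge *v x = 0"
  shows "x = (x $ u) *\<^sub>R 1"
proof (rule connected_graph_constant[OF assms(1)])
  fix i j assume "(i, j) \<in> E"
  then obtain e where "edge e = (i, j)"
    using bij by (metis (no_types) UNIV_I bij_betw_imp_surj_on imageE)
  then show "x $ i = x $ j"
    using incidence_mult[where edge = edge and e = e and x = x, OF edge_ends_differ] assms(2) by simp
qed

lemma incidence_kernel:
  assumes "connected_graph E" "incidence edge *v x = 0"
  shows "x = mean x *\<^sub>R 1"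
proof -
  obtain a where a: "x = a *\<^sub>R 1"
    using incidence_kernel_constant[OF assms] by blast
  then have "mean x = a"
    by (simp add: mean_def)
  with a show ?thesis
    by simp
qed

section \<open>Dual suboptimality\<close>

lemma dual_function_completed_square:
  "dual_function edge c y
    = 1 / 2 * (norm c)\<^sup>2 - 1 / 2 * (norm (c + transpose (incidence edge) *v y))\<^sup>2"
proof -
  have "(incidence edge *v c) \<bullet> y = c \<bullet> (transpose (incidence edge) *v y)"
    by (metis dot_lmul_matrix inner_commute transpose_matrix_vector)
  then show ?thesis
    unfolding dual_function_def
    by (simp add: power2_norm_eq_inner inner_add_left inner_add_right inner_commute algebra_simps
        del: transpose_matrix_vector)
qed

text \<open>
  A maximiser minimises \<open>\<parallel>c + A\<^sup>T y\<parallel>\<close>, so the minimal point is orthogonal to the range of \<open>A\<^sup>T\<close>.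
  It is thus in the kernel of \<open>A\<close>, that is constant, and its mean is that of \<open>c\<close>.
\<close>

lemma primal_of_dual_maximiser:
  assumes conn: "connected_graph E"
    and max: "\<forall>y. dual_function edge c y \<le> dual_function edge c ystar"
  shows "c + transpose (incidence edge) *v ystar = mean c *\<^sub>R 1"
proof -
  let ?T = "transpose (incidence edge)"
  let ?p = "c + ?T *v ystar"
  have "w \<bullet> (incidence edge *v ?p) = 0" for w
  proof -
    have "0 \<le> r * (2 * (?p \<bullet> (?T *v w))) + r\<^sup>2 * ((?T *v w) \<bullet> (?T *v w))" for r
    proof -
      have "(norm ?p)\<^sup>2 \<le> (norm (c + ?T *v (ystar + r *\<^sub>R w)))\<^sup>2"
        using max[rule_format, of "ystar + r *\<^sub>R w"]
        unfolding dual_function_completed_square by linarith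
      also have "c + ?T *v (ystar + r *\<^sub>R w) = ?p + r *\<^sub>R (?T *v w)"
        by (simp add: matrix_vector_right_distrib matrix_vector_mult_scaleR
            del: transpose_matrix_vector)
      also have "(norm \<dots>)\<^sup>2
          = (norm ?p)\<^sup>2 + r * (2 * (?p \<bullet> (?T *v w))) + r\<^sup>2 * ((?T *v w) \<bullet> (?T *v w))"
        by (rule norm_add_scaleR_squared)
      finally show ?thesis
        by linarith
    qed
    then have "?p \<bullet> (?T *v w) = 0"
      using linear_coefficient_zero by fastforce
    then show ?thesis
      by (metis dot_lmul_matrix inner_commute transpose_matrix_vector)
  qed
  then have "incidence edge *v ?p = 0"
    using inner_eq_zero_iff by blast
  then show ?thesis
    using incidence_kernel[OF conn] mean_add_transpose_incidence by metis
qed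

lemma dual_suboptimality:
  assumes "connected_graph E"
    and "\<forall>y. dual_function edge c y \<le> dual_function edge c ystar"
    and x: "x = c + transpose (incidence edge) *v y"
  shows "dual_function edge c ystar - dual_function edge c y
    = 1 / 2 * (norm (mean c *\<^sub>R 1 - x))\<^sup>2"
proof -
  have mean: "mean x = mean c"
    by (simp only: x mean_add_transpose_incidence)
  show ?thesis
    unfolding dual_function_completed_square primal_of_dual_maximiser[OF assms(1,2)] x[symmetric]
    using norm_diff_mean[of x] by (simp add: mean algebra_simps)
qed

section \<open>Algebraic connectivity and the lower bound\<close>

text \<open>
  The smallest Rayleigh quotient on the complement of the constants is an eigenvalue, and it is
  positive because connectedness confines the kernel to the constants. It is therefore the larger
  of two different eigenvalues, the other one being the eigenvalue \<open>0\<close> of the constants.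
\<close>

lemma algebraic_connectivity_le_rayleigh:
  assumes conn: "connected_graph E" and "mean z = 0"
  shows "algebraic_connectivity edge * (norm z)\<^sup>2 \<le> (norm (incidence edge *v z))\<^sup>2"
proof -
  let ?L = "laplacian edge"
  have L1: "?L *v 1 = 0 *\<^sub>R 1"
    unfolding laplacian_def matrix_vector_mul_assoc[symmetric] incidence_one by simp
  \<comment> \<open>The two ends of any edge provide a nonzero vector of mean 0.\<close>
  obtain p q :: 'v where pq: "p \<noteq> q"
    by (rule that[OF edge_ends_differ])
  let ?w = "axis p 1 - axis q 1 :: real ^ 'v"
  have "?w $ p \<noteq> 0"
    using pq by (simp add: axis_def)
  then have w0: "?w \<noteq> 0"
    by (metis zero_index)
  have w1: "?w \<bullet> 1 = 0"
    by (simp add: inner_diff_left inner_axis')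
  obtain v t where v: "v \<noteq> 0" "v \<bullet> 1 = 0" "?L *v v = t *\<^sub>R v"
    and min: "\<And>x. x \<bullet> 1 = 0 \<Longrightarrow> t * (x \<bullet> x) \<le> x \<bullet> (?L *v x)"
    using rayleigh_minimum_on_complement[OF transpose_laplacian L1 w0 w1] by blast
  have "incidence edge *v v \<noteq> 0"
  proof
    assume "incidence edge *v v = 0"
    then have "v = mean v *\<^sub>R 1"
      by (rule incidence_kernel[OF conn])
    moreover have "mean v = 0"
      using v(2) inner_one_eq_mean[of v] by (simp add: inner_commute)
    ultimately show False
      using v(1) by simp
  qed
  then have "0 < v \<bullet> (?L *v v)"
    by (simp add: inner_laplacian)
  then have "0 < t"
    by (metis inner_gt_zero_iff inner_scaleR_right v(1,3) zero_less_mult_pos2)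
  moreover have "poly (charpoly ?L) 0 = 0"
    unfolding charpoly_root_iff_eigenvalue using L1 by (intro exI[of _ 1]) simp
  moreover have "poly (charpoly ?L) t = 0"
    unfolding charpoly_root_iff_eigenvalue using v by blast
  ultimately have "algebraic_connectivity edge \<le> t"
    unfolding algebraic_connectivity_def by (intro second_eigenvalue_le)
  then have "algebraic_connectivity edge * (norm z)\<^sup>2 \<le> t * (z \<bullet> z)"
    by (simp add: power2_norm_eq_inner mult_right_mono)
  also have "\<dots> \<le> z \<bullet> (?L *v z)"
    using inner_one_eq_mean[of z] assms(2) by (intro min) (simp add: inner_commute)
  finally show ?thesis
    by (simp add: inner_laplacian power2_norm_eq_inner)
qed

lemma sum_edges_ge:
  fixes x :: "real ^ 'v"
  assumes "connected_graph E"
  shows "sqrt (algebraic_connectivity edge) * norm (mean x *\<^sub>R 1 - x)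
    \<le> (\<Sum>(i, j)\<in>E. \<bar>x $ i - x $ j\<bar>)"
proof -
  let ?z = "mean x *\<^sub>R 1 - x"
  have "mean ?z = 0"
    by (simp add: mean_def sum_subtractf)
  then have "algebraic_connectivity edge * (norm ?z)\<^sup>2 \<le> (norm (incidence edge *v ?z))\<^sup>2"
    by (rule algebraic_connectivity_le_rayleigh[OF assms])
  then have "sqrt (algebraic_connectivity edge * (norm ?z)\<^sup>2) \<le> norm (incidence edge *v ?z)"
    by (intro real_le_lsqrt) auto
  then have "sqrt (algebraic_connectivity edge) * norm ?z \<le> norm (incidence edge *v ?z)"
    by (simp add: real_sqrt_mult)
  also have "\<dots> = norm (incidence edge *v x)"
    by (simp add: matrix_vector_mult_diff_distrib matrix_vector_mult_scaleR incidence_one)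
  also have "\<dots> \<le> (\<Sum>e\<in>UNIV. \<bar>(incidence edge *v x) $ e\<bar>)"
    by (rule norm_le_l1_cart)
  also have "\<dots> = (\<Sum>(i, j)\<in>E. \<bar>x $ i - x $ j\<bar>)"
    by (rule sum_edges_eq_sum_incidence[symmetric])
  finally show ?thesis .
qed

end

section \<open>The dual gap and its estimates\<close>

theorem lemma1:
  fixes E :: "('v::finite \<times> 'v) set"
    and edge :: "'e::finite \<Rightarrow> 'v \<times> 'v"
    and c :: "real ^ 'v"
    and ystar :: "real ^ 'e"
    and \<epsilon> :: real
  assumes "simple_graph E"
    and "connected_graph E"
    and "bij_betw edge UNIV E"
    and "\<forall>y. dual_function edge c y \<le> dual_function edge c ystar"
    and "\<epsilon> > 0"
  shows "(\<forall>(y :: real ^ 'e) (x :: real ^ 'v). x = c + transpose (incidence edge) *v y \<longrightarrow>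
           dual_function edge c ystar - dual_function edge c y = 1 / 2 * (norm (mean c *\<^sub>R 1 - x))\<^sup>2) \<and>
    (\<forall>x :: real ^ 'v. mean x = mean c \<longrightarrow>
           1 / (2 * real CARD('v)) * (\<Sum>i\<in>UNIV. \<Sum>j\<in>UNIV. (x $ j - x $ i)\<^sup>2)
             = (norm (mean c *\<^sub>R 1 - x))\<^sup>2) \<and>
    (\<forall>x :: real ^ 'v. (\<Sum>(i, j)\<in>E. \<bar>x $ i - x $ j\<bar>)
           \<le> sqrt (real (card E) * real CARD('v)) * norm (mean c *\<^sub>R 1 - x)) \<and>
    (\<forall>x :: real ^ 'v. mean x = mean c \<longrightarrow>
           (\<Sum>(i, j)\<in>E. \<bar>x $ i - x $ j\<bar>)
             \<ge> sqrt (algebraic_connectivity edge) * norm (mean c *\<^sub>R 1 - x)) \<and>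
    (\<forall>x :: real ^ 'v. (\<Sum>(i, j)\<in>E. \<bar>x $ i - x $ j\<bar>)
           \<ge> \<epsilon> * real (card {(i, j) \<in> E. \<bar>x $ i - x $ j\<bar> \<ge> \<epsilon>}))"
proof (intro conjI allI impI)
  fix y :: "real ^ 'e" and x :: "real ^ 'v"
  assume "x = c + transpose (incidence edge) *v y"
  then show "dual_function edge c ystar - dual_function edge c y
      = 1 / 2 * (norm (mean c *\<^sub>R 1 - x))\<^sup>2"
    by (rule dual_suboptimality[OF assms(1,3,2,4)])
next
  fix x :: "real ^ 'v"
  assume "mean x = mean c"
  then show "1 / (2 * real CARD('v)) * (\<Sum>i\<in>UNIV. \<Sum>j\<in>UNIV. (x $ j - x $ i)\<^sup>2)
      = (norm (mean c *\<^sub>R 1 - x))\<^sup>2"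
    using sum_diff_mean[of x] by (simp add: sum_pairs_diff_squared[where a = "mean c"])
next
  fix x :: "real ^ 'v"
  show "(\<Sum>(i, j)\<in>E. \<bar>x $ i - x $ j\<bar>)
      \<le> sqrt (real (card E) * real CARD('v)) * norm (mean c *\<^sub>R 1 - x)"
    by (rule sum_edges_le[OF assms(1)])
next
  fix x :: "real ^ 'v"
  assume "mean x = mean c"
  then show "sqrt (algebraic_connectivity edge) * norm (mean c *\<^sub>R 1 - x)
      \<le> (\<Sum>(i, j)\<in>E. \<bar>x $ i - x $ j\<bar>)"
    using sum_edges_ge[OF assms(1,3,2), where x = x] by simp
next
  fix x :: "real ^ 'v"
  show "\<epsilon> * real (card {(i, j) \<in> E. \<epsilon> \<le> \<bar>x $ i - x $ j\<bar>}) \<le> (\<Sum>(i, j)\<in>E. \<bar>x $ i - x $ j\<bar>)"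
  proof -
    let ?f = "\<lambda>(i, j). \<bar>x $ i - x $ j\<bar>"
    have "{(i, j) \<in> E. \<epsilon> \<le> \<bar>x $ i - x $ j\<bar>} = {e \<in> E. \<epsilon> \<le> ?f e}"
      by auto
    then show ?thesis
      using sum_ge_threshold_times_card[of E ?f \<epsilon>] by auto
  qed
qed

end
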